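(* Let $K\subset\mathbf{R}^n$ be a set of positive reach. Suppose that the tangent cone $T_pK$ of $K$ at each boundary point $p\in\partial K$ is a half-space. Then $\partial K$ is $\mathcal{C}^1$, i.e., it is a $\mathcal{C}^1$ hypersurface.
   Context: A closed set $K\subset\mathbf{R}^n$ has positive reach if there exists $r>0$ such that every point in the neighborhood of $K$ of radius $r$ in $\mathbf{R}^n$ is closest to a unique point of $K$. Tangent cone: for $K\subset\mathbf{R}^n$ and $p\in K$, a ray with origin $p$ and direction $u\in\mathbf{S}^{n-1}$ is the set $\{p+tu : t\ge 0\}$; rays with origin $p$ are topologized by the distance $\|u-u'\|$ between directions. $T_pK$ is the union of all rays $\ell$ with origin $p$ for which there is a sequence $p_i\in K\smallsetminus\{p\}$ converging to $p$ such that the rays from $p$ through $p_i$ converge to $\ell$. A $\mathcal{C}^1$ hypersurface is a subset of $\mathbf{R}^n$ which may be represented locally (after a rigid motion) as the graph of a continuously differentiable function of $n-1$ variables. *)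

theory Defs
  imports "HOL-Analysis.Analysis"
begin

text \<open>
  Euclidean space is a type of class \<open>euclidean_space\<close>, so that \<open>n = DIM('a) \<ge> 1\<close> is arbitrary.
\<close>

text \<open>
  The neighbourhood of \<open>K\<close> is written as a union of balls rather than with \<^const>\<open>infdist\<close>,
  because \<^const>\<open>infdist\<close> is \<open>0\<close> for the empty set.
\<close>

definition positive_reach :: "'a::euclidean_space set \<Rightarrow> bool" where
  "positive_reach K \<longleftrightarrow> closed K \<and>
     (\<exists>r>0. \<forall>x \<in> (\<Union>p\<in>K. ball p r). \<exists>!y. y \<in> K \<and> (\<forall>z\<in>K. dist x y \<le> dist x z))"

definition ray :: "'a::euclidean_space \<Rightarrow> 'a \<Rightarrow> 'a set" where
  "ray p u = {p + t *\<^sub>R u |t. t \<ge> 0}"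

text \<open>
  The ray from \<open>p\<close> through \<open>q \<noteq> p\<close> has the unit direction \<open>sgn (q - p)\<close>, and rays converge when
  their directions do.
\<close>

definition tangent_cone :: "'a::euclidean_space set \<Rightarrow> 'a \<Rightarrow> 'a set" where
  "tangent_cone K p =
     \<Union>{ray p u |u. norm u = 1 \<and>
          (\<exists>q::nat \<Rightarrow> 'a. (\<forall>i. q i \<in> K - {p}) \<and> q \<longlonglongrightarrow> p \<and> (\<lambda>i. sgn (q i - p)) \<longlonglongrightarrow> u)}"

text \<open>
  Half-spaces are closed.  The boundary of one that occurs as a tangent cone at \<open>p\<close> automatically
  passes through \<open>p\<close>.
\<close>

definition half_space :: "'a::euclidean_space set \<Rightarrow> bool" where
  "half_space H \<longleftrightarrow> (\<exists>a b. a \<noteq> 0 \<and> H = {x. a \<bullet> x \<le> b})"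

definition rigid_motion :: "('a::euclidean_space \<Rightarrow> 'a) \<Rightarrow> bool" where
  "rigid_motion T \<longleftrightarrow> (\<exists>Q a. orthogonal_transformation Q \<and> T = (\<lambda>x. a + Q x))"

text \<open>
  Functions of \<open>n - 1\<close> variables are functions on the coordinate hyperplane orthogonal to a basis
  vector \<open>e\<close>; the argument \<open>W\<close> below is a relatively open subset of that hyperplane.  The
  derivative is taken along \<open>W\<close> only, and is represented by a continuous gradient field \<open>G\<close>, of
  which only the component orthogonal to \<open>e\<close> matters.
\<close>

definition coord_hyperplane :: "'a::euclidean_space \<Rightarrow> 'a set" where
  "coord_hyperplane e = {y. e \<bullet> y = 0}"

definition continuously_differentiable_on :: "'a::euclidean_space set \<Rightarrow> ('a \<Rightarrow> real) \<Rightarrow> bool" where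
  "continuously_differentiable_on W f \<longleftrightarrow>
     (\<exists>G. continuous_on W G \<and> (\<forall>y\<in>W. (f has_derivative (\<lambda>h. G y \<bullet> h)) (at y within W)))"

definition C1_hypersurface :: "'a::euclidean_space set \<Rightarrow> bool" where
  "C1_hypersurface M \<longleftrightarrow>
     (\<forall>p\<in>M. \<exists>U T e W f.
        open U \<and> p \<in> U \<and> rigid_motion T \<and> e \<in> Basis \<and>
        openin (top_of_set (coord_hyperplane e)) W \<and>
        continuously_differentiable_on W f \<and>
        T ` (M \<inter> U) = {y + f y *\<^sub>R e |y. y \<in> W})"

end

theory Submission
  imports Defs
begin

text \<open>
  Fix \<open>\<rho>\<close> smaller than the reach.  Positive reach yields, at every boundary point \<open>p\<close>, a ball of radius
  \<open>\<rho>\<close> that touches \<open>p\<close> and has no point of \<open>K\<close> in its interior.  At the nearest point of an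
  exterior point near \<open>K\<close> a small touching ball exists trivially; Brouwer's fixed point theorem
  inflates it to radius \<open>\<rho>\<close> (\<open>touching_normal_at_nearest_point\<close>), and since the radius is uniform,
  touching balls survive in the limit at all boundary points (\<open>frontier_has_touching_normal\<close>).

  A touching ball whose centre lies in direction \<open>v\<close> from \<open>p\<close> confines the tangent cone to the half-space
  opposite to \<open>v\<close>.  When the cone is itself a half-space, this determines \<open>v\<close>
  (\<open>touching_normal_unique\<close>).  Touching is a closed condition, so uniqueness makes the normal \<open>n p\<close>
  a continuous function of \<open>p\<close> (\<open>continuous_touching_normal_field\<close>).

  Near \<open>p\<close> all normals are close to \<open>N = n p\<close>.  The touching balls then leave room for at most one
  boundary point on each short segment parallel to \<open>N\<close>, and since such segments run from \<open>K\<close> to its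
  complement, there is one.  So the boundary is locally the graph of a function \<open>f\<close>
  (\<open>frontier_local_graph\<close>).  The touching inequality at one point of the graph bounds \<open>f\<close> from above
  by its first-order expansion up to a quadratic error; the inequality at the other point bounds it
  from below.  With the continuity of \<open>n\<close> this gives a continuous gradient
  (\<open>graph_continuously_differentiable\<close>).
\<close>

section \<open>Touching balls\<close>

text \<open>
  For a unit vector \<open>v\<close>, the inequality says that \<open>K\<close> misses the open ball of radius \<open>\<rho>\<close> about
  \<open>p + \<rho> v\<close>, which touches \<open>p\<close>: expand \<open>\<bar>y - p - \<rho> v\<bar>\<^sup>2 \<ge> \<rho>\<^sup>2\<close>.  In this form the condition is linear in \<open>v\<close>
  and closed in \<open>(p, v)\<close>.
\<close>
definition touching_normal :: "'a::euclidean_space set \<Rightarrow> real \<Rightarrow> 'a \<Rightarrow> 'a \<Rightarrow> bool" where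
  "touching_normal K \<rho> p v \<longleftrightarrow>
     norm v = 1 \<and> (\<forall>y\<in>K. 2 * \<rho> * (v \<bullet> (y - p)) \<le> (norm (y - p))\<^sup>2)"

definition unique_nearest :: "'a::euclidean_space set \<Rightarrow> real \<Rightarrow> bool" where
  "unique_nearest K r \<longleftrightarrow> 
    (\<forall>x \<in> (\<Union>p\<in>K. ball p r). \<exists>!y. y \<in> K \<and> (\<forall>z\<in>K. dist x y \<le> dist x z))"

lemma unique_nearest_eqI:
  assumes "unique_nearest K r" "p \<in> K" "dist x p < r"
    and "y \<in> K" "\<And>z. z \<in> K \<Longrightarrow> dist x y \<le> dist x z"
    and "y' \<in> K" "\<And>z. z \<in> K \<Longrightarrow> dist x y' \<le> dist x z"
  shows "y = y'"
proof -
  have "x \<in> (\<Union>p\<in>K. ball p r)"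
    using assms(2,3) by (auto simp: dist_commute)
  then show ?thesis
    using assms(1,4-) unfolding unique_nearest_def by blast
qed

text \<open>
  Limits of nearest points are nearest points, so uniqueness makes the graph of the projection
  closed; since the projection of a bounded set is bounded, this is continuity.
\<close>
lemma continuous_on_nearest_point:
  assumes "closed K" and U: "unique_nearest K r"
    and p: "p \<in> K" and r: "\<And>x. x \<in> B \<Longrightarrow> dist x p < r" and "closed B"
  shows "continuous_on B (closest_point K)"
proof (rule continuous_from_closed_graph)
  have ne: "K \<noteq> {}" using p by auto
  note cp = closest_point_in_set[OF \<open>closed K\<close> ne] closest_point_le[OF \<open>closed K\<close>]
  show "compact (K \<inter> cball p (2 * r))"
    using \<open>closed K\<close> by (simp add: closed_Int_compact)
  show "closest_point K \<in> B \<rightarrow> K \<inter> cball p (2 * r)"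
  proof
    fix x assume "x \<in> B"
    have "dist p (closest_point K x) \<le> dist x p + dist x (closest_point K x)"
      by (metis dist_commute dist_triangle)
    also have "\<dots> \<le> 2 * r"
      using cp(2)[OF p, of x] r[OF \<open>x \<in> B\<close>] by linarith
    finally show "closest_point K x \<in> K \<inter> cball p (2 * r)"
      using cp(1) by simp
  qed
  have "(\<lambda>x. (x, closest_point K x)) ` B
      = (B \<times> K) \<inter> (\<Inter>z\<in>K. {q. dist (fst q) (snd q) \<le> dist (fst q) z})" (is "?L = ?R")
  proof (intro equalityI subsetI)
    fix q assume "q \<in> ?L" then show "q \<in> ?R" using cp by auto
  next
    fix q assume q: "q \<in> ?R"
    have "snd q = closest_point K (fst q)"
      by (rule unique_nearest_eqI[OF U p r, where x = "fst q"]) (use q cp in auto)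
    then show "q \<in> ?L" using q by (auto simp: image_iff mem_Times_iff prod_eq_iff)
  qed
  moreover have "closed ?R"
    by (intro closed_Int closed_Times \<open>closed B\<close> \<open>closed K\<close> closed_INT ballI closed_Collect_le
        continuous_intros)
  ultimately show "closed ((\<lambda>x. (x, closest_point K x)) ` B)" by simp
qed

text \<open>
  A ball outside \<open>K\<close> that touches \<open>K\<close> at \<open>a\<close> can be inflated, keeping the contact point, to any radius
  \<open>\<rho> < r\<close>.  With \<open>c\<close> the projection to \<open>K\<close>, the map that sends \<open>z\<close> to the point at distance
  \<open>\<epsilon> = \<rho> - dist x a\<close> from \<open>x\<close> in the direction away from \<open>c z\<close> is continuous on \<open>cball x \<epsilon>\<close>, so it has
  a fixed point \<open>w\<close> by Brouwer.  Then \<open>x\<close> lies between \<open>c w\<close> and \<open>w\<close>, which forces \<open>c w = a\<close> and makes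
  \<open>w\<close> the centre of the ball of radius \<open>\<rho>\<close>.
\<close>
lemma touching_normal_at_nearest_point:
  assumes "closed K" and U: "unique_nearest K r"
    and a: "a \<in> K" and near: "\<And>z. z \<in> K \<Longrightarrow> dist x a \<le> dist x z"
    and x: "x \<notin> K" and d: "dist x a < \<rho>" and "\<rho> < r"
  shows "touching_normal K \<rho> a (sgn (x - a))"
proof -
  define c where "c = closest_point K"
  define \<epsilon> where "\<epsilon> = \<rho> - dist x a"
  have ne: "K \<noteq> {}" using a by auto
  have cK: "c z \<in> K" and cle: "y \<in> K \<Longrightarrow> dist z (c z) \<le> dist z y" for y z
    unfolding c_def using closest_point_in_set[OF \<open>closed K\<close> ne] closest_point_le[OF \<open>closed K\<close>] by auto
  have "\<epsilon> > 0" using d by (simp add: \<epsilon>_def)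
  have B: "dist z a < r" if "z \<in> cball x \<epsilon>" for z
  proof -
    have "dist z a \<le> dist x z + dist x a" by (metis dist_commute dist_triangle)
    then show ?thesis using that \<open>\<rho> < r\<close> by (simp add: \<epsilon>_def)
  qed
  have nz: "x \<noteq> c z" for z using cK x by metis
  define F where "F z = x + (\<epsilon> / norm (x - c z)) *\<^sub>R (x - c z)" for z
  have "continuous_on (cball x \<epsilon>) c"
    unfolding c_def by (rule continuous_on_nearest_point[OF \<open>closed K\<close> U a B]) auto
  then have contF: "continuous_on (cball x \<epsilon>) F"
    unfolding F_def by (intro continuous_intros) (auto simp: nz)
  have "F \<in> cball x \<epsilon> \<rightarrow> cball x \<epsilon>"
    using \<open>\<epsilon> > 0\<close> nz by (auto simp: F_def dist_norm)
  then obtain w where w: "w \<in> cball x \<epsilon>" "F w = w"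
    using brouwer[of "cball x \<epsilon>" F] contF \<open>\<epsilon> > 0\<close> by auto
  \<comment> \<open>\<open>x\<close> lies between \<open>w\<close> and the nearest point of \<open>w\<close>, which is therefore also nearest to \<open>x\<close>\<close>
  have wx: "w - x = (\<epsilon> / norm (x - c w)) *\<^sub>R (x - c w)"
    using w(2) unfolding F_def by (metis add_diff_cancel_left')
  have "dist w x = \<epsilon>" using wx nz \<open>\<epsilon> > 0\<close> by (simp add: dist_norm)
  have "w - c w = (1 + \<epsilon> / norm (x - c w)) *\<^sub>R (x - c w)"
    using wx by (simp add: algebra_simps)
  then have "dist w (c w) = (1 + \<epsilon> / norm (x - c w)) * norm (x - c w)"
    using \<open>\<epsilon> > 0\<close> by (simp add: dist_norm)
  then have dw: "dist w (c w) = dist x (c w) + \<epsilon>"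
    using nz[of w] by (simp add: dist_norm distrib_right)
  have "c w = a"
  proof (rule unique_nearest_eqI[OF U a _ cK _ a near])
    show "dist x a < r" using d \<open>\<rho> < r\<close> by simp
    show "dist x (c w) \<le> dist x z" if "z \<in> K" for z
      using cle[OF that, of w] dw \<open>dist w x = \<epsilon>\<close> dist_triangle[of w z x] by linarith
  qed
  have dpos: "dist x a > 0" using nz[of w] \<open>c w = a\<close> by simp
  have wa: "w - a = \<rho> *\<^sub>R sgn (x - a)"
  proof -
    have "w - a = (1 + \<epsilon> / norm (x - a)) *\<^sub>R (x - a)"
      using \<open>w - c w = _\<close> \<open>c w = a\<close> by simp
    also have "1 + \<epsilon> / norm (x - a) = \<rho> / norm (x - a)"
      using dpos by (simp add: \<epsilon>_def dist_norm field_simps)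
    finally show ?thesis by (simp add: sgn_div_norm divide_inverse)
  qed
  have dwa: "dist w a = \<rho>" using dw \<open>c w = a\<close> by (simp add: \<epsilon>_def)
  show ?thesis unfolding touching_normal_def
  proof (intro conjI ballI)
    show "norm (sgn (x - a)) = 1" using dpos by (simp add: norm_sgn)
    fix y assume "y \<in> K"
    have "norm (w - a) \<le> norm (w - y)"
      using cle[OF \<open>y \<in> K\<close>, of w] \<open>c w = a\<close> by (simp add: dist_norm)
    then have "(norm (w - a))\<^sup>2 \<le> (norm ((w - a) - (y - a)))\<^sup>2" by simp
    also have "\<dots> = (norm (w - a))\<^sup>2 + (norm (y - a))\<^sup>2 - 2 * ((w - a) \<bullet> (y - a))"
      by (simp only: power2_norm_eq_inner) (simp add: inner_diff inner_commute)
    finally show "2 * \<rho> * (sgn (x - a) \<bullet> (y - a)) \<le> (norm (y - a))\<^sup>2"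
      by (simp add: wa)
  qed
qed

text \<open>
  The points \<open>p + s v\<close> with \<open>0 < s < 2 \<rho>\<close> lie in the touching ball, hence outside \<open>K\<close>.
\<close>
lemma touching_normal_imp_frontier:
  assumes "touching_normal K \<rho> p v" "p \<in> K" "\<rho> > 0"
  shows "p \<in> frontier K"
proof (rule ccontr)
  assume "p \<notin> frontier K"
  then have "p \<in> interior K" using \<open>p \<in> K\<close> closure_subset by (auto simp: frontier_def)
  then obtain e where e: "e > 0" "cball p e \<subseteq> K" by (auto simp: mem_interior_cball)
  define s where "s = min e \<rho>"
  have s: "0 < s" "s \<le> e" "s \<le> \<rho>" using e assms by (auto simp: s_def)
  have v: "norm v = 1" using assms by (simp add: touching_normal_def)
  then have "p + s *\<^sub>R v \<in> K" using e s by (auto simp: dist_norm)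
  then have "2 * \<rho> * (v \<bullet> (s *\<^sub>R v)) \<le> (norm (s *\<^sub>R v))\<^sup>2"
    using assms unfolding touching_normal_def by (metis add_diff_cancel_left')
  then have "2 * \<rho> * s \<le> s * s" using v s by (simp add: norm_eq_1 power2_eq_square)
  then show False using s by simp
qed

lemma closed_touching_normals:
  assumes "closed K"
  shows "closed {(p, v). p \<in> frontier K \<and> touching_normal K \<rho> p v}"
proof -
  have "{(p, v). p \<in> frontier K \<and> touching_normal K \<rho> p v}
    = (frontier K \<times> sphere 0 1) \<inter>
      (\<Inter>y\<in>K. {q. 2 * \<rho> * (snd q \<bullet> (y - fst q)) \<le> (norm (y - fst q))\<^sup>2})"
    by (auto simp: touching_normal_def)
  moreover have "closed \<dots>"
    by (intro closed_Int closed_Times closed_INT ballI closed_Collect_le continuous_intros) auto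
  ultimately show ?thesis by simp
qed

text \<open>
  Points outside \<open>K\<close> near \<open>p\<close> have their nearest points near \<open>p\<close>, and at these there are touching
  normals.  All of them have the same radius \<open>\<rho>\<close>, so compactness of the unit sphere gives one at \<open>p\<close>.
\<close>
lemma frontier_has_touching_normal:
  assumes "closed K" and U: "unique_nearest K r" and \<rho>: "0 < \<rho>" "\<rho> < r"
    and p: "p \<in> frontier K"
  shows "\<exists>v. touching_normal K \<rho> p v"
proof -
  define N where "N = {(p, v). p \<in> frontier K \<and> touching_normal K \<rho> p v}"
  define C where "C = N \<inter> (cball p 1 \<times> sphere 0 1)"
  have pK: "p \<in> K" using p \<open>closed K\<close> by (simp add: frontier_def)
  have "compact C"
    unfolding C_def N_def by (intro closed_Int_compact closed_touching_normals \<open>closed K\<close> compact_Times) auto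
  then have "closed (fst ` C)"
    by (intro compact_imp_closed compact_continuous_image continuous_intros)
  moreover have "p \<in> closure (fst ` C)"
    unfolding closure_approachable
  proof (intro allI impI)
    fix e :: real assume "e > 0"
    define s where "s = min (min (e/2) (1/2)) \<rho>"
    have s: "s > 0" "s \<le> e/2" "s \<le> 1/2" "s \<le> \<rho>" using \<open>e > 0\<close> \<rho> by (auto simp: s_def)
    have "p \<in> closure (- K)" using p by (simp add: frontier_closures)
    then obtain x where x: "x \<notin> K" "dist x p < s"
      using s by (auto simp: closure_approachable)
    obtain a where a: "a \<in> K" "\<And>z. z \<in> K \<Longrightarrow> dist x a \<le> dist x z"
      using distance_attains_inf[OF \<open>closed K\<close>, of x] pK by blast
    have "dist x a < \<rho>" using a(2)[OF pK] x(2) s(4) by linarith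
    then have t: "touching_normal K \<rho> a (sgn (x - a))"
      using touching_normal_at_nearest_point[OF \<open>closed K\<close> U a x(1)] \<rho>(2) by blast
    have "dist a p \<le> dist x a + dist x p" by (metis dist_commute dist_triangle)
    then have "dist a p < 2 * s" using a(2)[OF pK] x s by linarith
    moreover have "(a, sgn (x - a)) \<in> C"
      using t touching_normal_imp_frontier[OF t a(1) \<rho>(1)] \<open>dist a p < 2 * s\<close> s
      by (auto simp: C_def N_def touching_normal_def dist_commute)
    then have "a \<in> fst ` C" by force
    ultimately show "\<exists>y\<in>fst ` C. dist y p < e" using s by (intro bexI[of _ a]) auto
  qed
  ultimately show ?thesis by (auto simp: C_def N_def)
qed

section \<open>Half-space tangent cones and the normal field\<close>

text \<open>
  Divide the touching inequality by \<open>\<bar>q - p\<bar>\<close> and let \<open>q \<rightarrow> p\<close> in \<open>K\<close>: the quadratic term disappears.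
\<close>
lemma tangent_cone_subset_touching_half_space:
  assumes v: "touching_normal K \<rho> p v" and \<rho>: "\<rho> > 0" and x: "x \<in> tangent_cone K p"
  shows "v \<bullet> (x - p) \<le> 0"
proof -
  from x obtain u q t where q: "\<And>i::nat. q i \<in> K - {p}" "q \<longlonglongrightarrow> p" "(\<lambda>i. sgn (q i - p)) \<longlonglongrightarrow> u"
    and t: "t \<ge> 0" "x = p + t *\<^sub>R u"
    unfolding tangent_cone_def ray_def by blast
  have "v \<bullet> u \<le> 0"
  proof (rule LIMSEQ_le)
    show "(\<lambda>i. v \<bullet> sgn (q i - p)) \<longlonglongrightarrow> v \<bullet> u" by (intro tendsto_intros q)
    have "(\<lambda>i. norm (q i - p) / (2 * \<rho>)) \<longlonglongrightarrow> norm (p - p) / (2 * \<rho>)"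
      using \<rho> by (intro tendsto_intros q) auto
    then show "(\<lambda>i. norm (q i - p) / (2 * \<rho>)) \<longlonglongrightarrow> 0" by simp
    have "v \<bullet> sgn (q i - p) \<le> norm (q i - p) / (2 * \<rho>)" for i
    proof -
      define m where "m = norm (q i - p)"
      have m: "m > 0" using q(1)[of i] by (simp add: m_def)
      have "2 * \<rho> * (v \<bullet> (q i - p)) \<le> m * m"
        using v q(1)[of i] by (simp add: touching_normal_def m_def power2_eq_square)
      then have "v \<bullet> (q i - p) / m \<le> m / (2 * \<rho>)" using m \<rho> by (simp add: field_simps)
      moreover have "v \<bullet> sgn (q i - p) = v \<bullet> (q i - p) / m"
        unfolding sgn_div_norm inner_scaleR_right m_def by (rule divide_inverse_commute[symmetric])
      ultimately show ?thesis unfolding m_def by (simp only:)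
    qed
    then show "\<exists>n. \<forall>i\<ge>n. v \<bullet> sgn (q i - p) \<le> norm (q i - p) / (2 * \<rho>)" by blast
  qed
  then show ?thesis using t by (simp add: mult_nonneg_nonpos)
qed

text \<open>
  A linear form that is bounded above on \<open>{x. a \<bullet> x \<le> b}\<close> is a nonnegative multiple of \<open>a\<close>:
  it is nonpositive on every direction \<open>w\<close> with \<open>a \<bullet> w \<le> 0\<close>, because \<open>w\<close> can be followed to infinity.
\<close>
lemma normal_of_half_space:
  fixes a v p :: "'a::euclidean_space"
  assumes "a \<noteq> 0" and v: "norm v = 1" and le: "\<And>x. a \<bullet> x \<le> b \<Longrightarrow> v \<bullet> (x - p) \<le> 0"
  shows "v = sgn a"
proof -
  have aa: "a \<bullet> a > 0" using \<open>a \<noteq> 0\<close> by simp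
  define x0 where "x0 = (b / (a \<bullet> a)) *\<^sub>R a"
  have x0: "a \<bullet> x0 = b" using aa by (simp add: x0_def)
  have dir: "v \<bullet> w \<le> 0" if "a \<bullet> w \<le> 0" for w
  proof (rule ccontr)
    assume "\<not> v \<bullet> w \<le> 0"
    then have vw: "v \<bullet> w > 0" by simp
    define s where "s = (\<bar>v \<bullet> (x0 - p)\<bar> + 1) / (v \<bullet> w)"
    have "s \<ge> 0" using vw by (simp add: s_def)
    then have "a \<bullet> (x0 + s *\<^sub>R w) \<le> b" using that x0 by (simp add: inner_right_distrib mult_nonneg_nonpos)
    from le[OF this] have "v \<bullet> (x0 - p) + s * (v \<bullet> w) \<le> 0" by (simp add: inner_right_distrib inner_diff_right)
    moreover have "s * (v \<bullet> w) = \<bar>v \<bullet> (x0 - p)\<bar> + 1" using vw by (simp add: s_def)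
    ultimately show False by linarith
  qed
  define c where "c = (a \<bullet> v) / (a \<bullet> a)"
  define w where "w = v - c *\<^sub>R a"
  have aw: "a \<bullet> w = 0" using aa by (simp add: w_def c_def inner_diff_right)
  have "v \<bullet> w \<le> 0" using dir aw by simp
  moreover have "v \<bullet> w = w \<bullet> w" using aw by (simp add: w_def inner_diff_left)
  ultimately have "w = 0" by (metis inner_gt_zero_iff not_le)
  then have vc: "v = c *\<^sub>R a" by (simp add: w_def)
  have "v \<bullet> (- a) \<le> 0" using dir[of "-a"] by simp
  then have "c * (a \<bullet> a) \<ge> 0" using vc by simp
  then have "c \<ge> 0" using aa by (simp add: zero_le_mult_iff)
  moreover have "c \<noteq> 0" using v vc by auto
  ultimately have "sgn v = sgn a" using vc by (simp add: sgn_scaleR)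
  then show ?thesis using v by (simp add: sgn_div_norm)
qed

lemma touching_normal_unique:
  assumes "half_space (tangent_cone K p)" and \<rho>: "\<rho> > 0"
    and v: "touching_normal K \<rho> p v" and w: "touching_normal K \<rho> p w"
  shows "v = w"
proof -
  obtain a b where a: "a \<noteq> 0" and H: "tangent_cone K p = {x. a \<bullet> x \<le> b}"
    using assms(1) by (auto simp: half_space_def)
  have eq: "u = sgn a" if u: "touching_normal K \<rho> p u" for u
  proof (rule normal_of_half_space[OF a])
    show "norm u = 1" using u by (simp add: touching_normal_def)
    show "u \<bullet> (x - p) \<le> 0" if "a \<bullet> x \<le> b" for x
      by (rule tangent_cone_subset_touching_half_space[OF u \<rho>]) (simp add: H that)
  qed
  show ?thesis using eq[OF v] eq[OF w] by simp
qed

lemma continuous_touching_normal_field: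
  fixes K :: "'a::euclidean_space set" and n :: "'a \<Rightarrow> 'a"
  assumes "closed K"
    and ex: "\<And>p. p \<in> frontier K \<Longrightarrow> touching_normal K \<rho> p (n p)"
    and unique: "\<And>p v. p \<in> frontier K \<Longrightarrow> touching_normal K \<rho> p v \<Longrightarrow> v = n p"
  shows "continuous_on (frontier K) n"
proof -
  have no: "norm (n p) = 1" if "p \<in> frontier K" for p
    using ex[OF that] unfolding touching_normal_def by blast
  have pi: "n \<in> frontier K \<rightarrow> sphere 0 1" using no by simp
  have "(p, v) \<in> (\<lambda>p. (p, n p)) ` frontier K \<longleftrightarrow> p \<in> frontier K \<and> touching_normal K \<rho> p v" for p v
  proof
    assume "(p, v) \<in> (\<lambda>p. (p, n p)) ` frontier K"
    then show "p \<in> frontier K \<and> touching_normal K \<rho> p v" using ex by blast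
  next
    assume "p \<in> frontier K \<and> touching_normal K \<rho> p v"
    then show "(p, v) \<in> (\<lambda>p. (p, n p)) ` frontier K" using unique[of p v] by blast
  qed
  then have "(\<lambda>p. (p, n p)) ` frontier K = {(p, v). p \<in> frontier K \<and> touching_normal K \<rho> p v}"
    by (intro set_eqI) (simp only: split_paired_all mem_Collect_eq split_conv)
  then have "closed ((\<lambda>p. (p, n p)) ` frontier K)"
    using closed_touching_normals[OF \<open>closed K\<close>, of \<rho>] by simp
  then show ?thesis by (rule continuous_from_closed_graph[OF compact_sphere pi])
qed

section \<open>The boundary as a graph\<close>

text \<open>
  Write the touching inequality at \<open>y + f y N\<close> for the point over \<open>y'\<close>.  Where the oscillation of \<open>f\<close>
  is at most \<open>\<rho> / 2\<close>, the term \<open>(f y' - f y)\<^sup>2\<close> is absorbed and \<open>f\<close> comes out Lipschitz.  The inequality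
  then says that \<open>f\<close> lies below its first-order expansion with gradient \<open>G y\<close>, up to a quadratic
  error.  Exchanging \<open>y\<close> and \<open>y'\<close> gives the bound from below with \<open>G y'\<close> in place of \<open>G y\<close>, and
  continuity of \<open>G\<close> closes the gap.
\<close>
lemma graph_continuously_differentiable:
  fixes N :: "'a::euclidean_space" and n :: "'a \<Rightarrow> 'a"
  assumes N: "norm N = 1" and \<rho>: "\<rho> > 0"
    and orth: "\<And>y. y \<in> W \<Longrightarrow> N \<bullet> y = 0"
    and small: "\<And>y y'. y \<in> W \<Longrightarrow> y' \<in> W \<Longrightarrow> norm (y' - y) \<le> \<rho> / 2"
      "\<And>y y'. y \<in> W \<Longrightarrow> y' \<in> W \<Longrightarrow> \<bar>f y' - f y\<bar> \<le> \<rho> / 2"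
    and graph: "\<And>y. y \<in> W \<Longrightarrow> y + f y *\<^sub>R N \<in> M"
    and cont: "continuous_on M n"
    and unit: "\<And>q. q \<in> M \<Longrightarrow> norm (n q) = 1"
    and slope: "\<And>y. y \<in> W \<Longrightarrow> n (y + f y *\<^sub>R N) \<bullet> N \<ge> 1 / 2"
    and touch: "\<And>q q'. q \<in> M \<Longrightarrow> q' \<in> M \<Longrightarrow> 2 * \<rho> * (n q \<bullet> (q' - q)) \<le> (norm (q' - q))\<^sup>2"
  shows "continuously_differentiable_on W f"
proof -
  define \<nu> where "\<nu> y = n (y + f y *\<^sub>R N)" for y
  \<comment> \<open>the hyperplane orthogonal to \<open>\<nu> y\<close> has the slope vector minus the tangential part of \<open>\<nu> y\<close>
    over its \<open>N\<close>-part; the component of \<open>G y\<close> along \<open>N\<close> pairs to \<open>0\<close> with differences of points of \<open>W\<close>\<close>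
  define G where "G y = - (1 / (\<nu> y \<bullet> N)) *\<^sub>R \<nu> y" for y
  have \<nu>N: "\<nu> y \<bullet> N \<ge> 1 / 2" if "y \<in> W" for y
    using slope[OF that] by (simp add: \<nu>_def)
  have main: "2 * \<rho> * (\<nu> y \<bullet> (y' - y) + (f y' - f y) * (\<nu> y \<bullet> N))
      \<le> (norm (y' - y))\<^sup>2 + (f y' - f y)\<^sup>2" if "y \<in> W" "y' \<in> W" for y y'
  proof -
    have eq: "(y' + f y' *\<^sub>R N) - (y + f y *\<^sub>R N) = (y' - y) + (f y' - f y) *\<^sub>R N"
      by (simp add: algebra_simps)
    have "orthogonal (y' - y) ((f y' - f y) *\<^sub>R N)"
      using orth[OF that(1)] orth[OF that(2)]
      by (simp add: orthogonal_def inner_diff_right inner_commute[of _ N])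
    then have "(norm ((y' - y) + (f y' - f y) *\<^sub>R N))\<^sup>2 = (norm (y' - y))\<^sup>2 + (f y' - f y)\<^sup>2"
      using N by (simp add: norm_add_Pythagorean)
    then show ?thesis
      using touch[OF graph[OF that(1)] graph[OF that(2)]] unfolding eq \<nu>_def
      by (simp add: inner_add_right)
  qed
  have lip1: "f y' - f y \<le> 5 * norm (y' - y)" if y: "y \<in> W" and y': "y' \<in> W" for y y'
  proof (cases "f y' - f y \<le> 0")
    case True
    then show ?thesis by (smt (verit) norm_ge_zero)
  next
    case False
    define m where "m = norm (y' - y)"
    define \<Delta> where "\<Delta> = f y' - f y"
    have \<Delta>: "0 < \<Delta>" "\<Delta> \<le> \<rho> / 2" using False small(2)[OF y y'] by (auto simp: \<Delta>_def)
    have m: "0 \<le> m" "m \<le> \<rho> / 2" using small(1)[OF y y'] by (auto simp: m_def)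
    have "\<bar>\<nu> y \<bullet> (y' - y)\<bar> \<le> norm (\<nu> y) * m" unfolding m_def by (rule Cauchy_Schwarz_ineq2)
    then have "\<nu> y \<bullet> (y' - y) \<ge> - m" using unit[OF graph[OF y]] by (simp add: \<nu>_def)
    moreover have "\<Delta> * (\<nu> y \<bullet> N) \<ge> \<Delta> * (1 / 2)"
      using \<nu>N[OF y] \<Delta> by (intro mult_left_mono) auto
    ultimately have "2 * \<rho> * (- m + \<Delta> * (1 / 2)) \<le> 2 * \<rho> * (\<nu> y \<bullet> (y' - y) + \<Delta> * (\<nu> y \<bullet> N))"
      using \<rho> by (intro mult_left_mono) auto
    also have "\<dots> \<le> m * m + \<Delta> * \<Delta>"
      using main[OF y y'] by (simp add: m_def \<Delta>_def power2_eq_square)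
    also have "\<dots> \<le> (\<rho> / 2) * m + (\<rho> / 2) * \<Delta>"
      using m \<Delta> by (intro add_mono mult_right_mono) auto
    finally have "\<rho> * \<Delta> \<le> \<rho> * (5 * m)" by (simp add: algebra_simps)
    then show ?thesis using \<rho> by (simp add: m_def \<Delta>_def)
  qed
  have lip: "\<bar>f y' - f y\<bar> \<le> 5 * norm (y' - y)" if "y \<in> W" "y' \<in> W" for y y'
    using lip1[OF that] lip1[OF that(2) that(1)] by (simp add: norm_minus_commute abs_le_iff)
  have upper: "f y' - f y - G y \<bullet> (y' - y) \<le> 26 / \<rho> * (norm (y' - y))\<^sup>2" if y: "y \<in> W" and y': "y' \<in> W" for y y'
  proof -
    define m where "m = (norm (y' - y))\<^sup>2"
    define c where "c = \<nu> y \<bullet> N"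
    have c: "c \<ge> 1 / 2" using \<nu>N[OF y] by (simp add: c_def)
    have "(f y' - f y)\<^sup>2 \<le> (5 * norm (y' - y))\<^sup>2"
      using lip[OF y y'] by (metis abs_ge_zero power2_abs power_mono)
    then have "(f y' - f y)\<^sup>2 \<le> 25 * m" by (simp add: m_def power_mult_distrib)
    then have "2 * \<rho> * (\<nu> y \<bullet> (y' - y) + (f y' - f y) * c) \<le> 26 * m"
      using main[OF y y'] by (simp add: m_def c_def)
    moreover have "\<nu> y \<bullet> (y' - y) + (f y' - f y) * c = c * (f y' - f y - G y \<bullet> (y' - y))"
      using c by (simp add: G_def c_def[symmetric] field_simps)
    ultimately have *: "2 * \<rho> * c * (f y' - f y - G y \<bullet> (y' - y)) \<le> 26 * m" by (simp add: mult.assoc)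
    show ?thesis
    proof (cases "f y' - f y - G y \<bullet> (y' - y) \<le> 0")
      case True
      moreover have "26 / \<rho> * (norm (y' - y))\<^sup>2 \<ge> 0" using \<rho> by simp
      ultimately show ?thesis by linarith
    next
      case False
      have "\<rho> * (f y' - f y - G y \<bullet> (y' - y)) \<le> 2 * \<rho> * c * (f y' - f y - G y \<bullet> (y' - y))"
        using False c \<rho> by (intro mult_right_mono) auto
      with * have "\<rho> * (f y' - f y - G y \<bullet> (y' - y)) \<le> 26 * m" by linarith
      then show ?thesis using \<rho> by (simp add: m_def field_simps)
    qed
  qed
  have "continuous_on W f"
    unfolding continuous_on_iff
  proof (intro ballI allI impI)
    fix y e assume "y \<in> W" "(0::real) < e"
    then show "\<exists>d>0. \<forall>y'\<in>W. dist y' y < d \<longrightarrow> dist (f y') (f y) < e"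
      using lip[of y] by (intro exI[of _ "e / 5"]) (fastforce simp: dist_norm)
  qed
  then have "continuous_on W (\<lambda>y. y + f y *\<^sub>R N)" by (intro continuous_intros)
  then have cont\<nu>: "continuous_on W \<nu>"
    unfolding \<nu>_def using graph by (intro continuous_on_compose2[OF cont]) auto
  have contG: "continuous_on W G"
    unfolding G_def using \<nu>N by (intro continuous_intros cont\<nu>) fastforce
  moreover have "(f has_derivative (\<lambda>h. G y \<bullet> h)) (at y within W)" if y: "y \<in> W" for y
    unfolding has_derivative_within_alt
  proof (intro conjI allI impI)
    show "bounded_linear ((\<bullet>) (G y))" by (rule bounded_linear_inner_right)
    fix e :: real assume "e > 0"
    then obtain d1 where d1: "d1 > 0" "\<And>y'. y' \<in> W \<Longrightarrow> dist y' y < d1 \<Longrightarrow> dist (G y') (G y) < e / 2"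
      using contG y unfolding continuous_on_iff by (meson half_gt_zero)
    \<comment> \<open>this makes \<open>26 / \<rho> * \<bar>y' - y\<bar>\<close> at most \<open>e / 2\<close>, so each of the two errors costs half of \<open>e\<close>\<close>
    define d where "d = min d1 (e * \<rho> / 52)"
    have "norm (f y' - f y - G y \<bullet> (y' - y)) \<le> e * norm (y' - y)"
      if y': "y' \<in> W" and near: "norm (y' - y) < d" for y'
    proof -
      define m where "m = norm (y' - y)"
      have m: "0 \<le> m" "m \<le> e * \<rho> / 52" using near by (auto simp: m_def d_def)
      have "26 / \<rho> * m \<le> 26 / \<rho> * (e * \<rho> / 52)" using m \<rho> by (intro mult_left_mono) auto
      then have "26 / \<rho> * m \<le> e / 2" using \<rho> by simp
      then have "26 / \<rho> * m * m \<le> e / 2 * m" using m by (intro mult_right_mono) auto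
      then have quad: "26 / \<rho> * m\<^sup>2 \<le> e / 2 * m" by (simp add: power2_eq_square)
      have "\<bar>(G y' - G y) \<bullet> (y' - y)\<bar> \<le> norm (G y' - G y) * m"
        unfolding m_def by (rule Cauchy_Schwarz_ineq2)
      also have "\<dots> \<le> e / 2 * m"
        using d1(2)[OF y'] near m by (intro mult_right_mono) (auto simp: dist_norm d_def)
      finally have G: "\<bar>G y' \<bullet> (y' - y) - G y \<bullet> (y' - y)\<bar> \<le> e / 2 * m"
        by (simp add: inner_diff_left)
      have "f y' - f y - G y \<bullet> (y' - y) \<le> e / 2 * m"
        using upper[OF y y'] quad by (simp add: m_def)
      moreover have "f y - f y' - G y' \<bullet> (y - y') \<le> e / 2 * m"
        using upper[OF y' y] quad by (simp add: m_def norm_minus_commute)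
      then have "f y - f y' + G y' \<bullet> (y' - y) \<le> e / 2 * m" by (simp add: inner_diff_right)
      moreover have "0 \<le> e / 2 * m" using m \<open>e > 0\<close> by simp
      ultimately have "\<bar>f y' - f y - G y \<bullet> (y' - y)\<bar> \<le> e / 2 * m + e / 2 * m" using G by linarith
      then show ?thesis by (simp add: m_def)
    qed
    moreover have "d > 0" using d1 \<open>e > 0\<close> \<rho> by (simp add: d_def)
    ultimately show "\<exists>d>0. \<forall>y'\<in>W. norm (y' - y) < d \<longrightarrow>
        norm (f y' - f y - G y \<bullet> (y' - y)) \<le> e * norm (y' - y)" by blast
  qed
  ultimately show ?thesis unfolding continuously_differentiable_on_def by blast
qed

text \<open>
  Take a thin cylinder about \<open>p\<close> with axis \<open>N = n p\<close>, where all normals make a definite angle with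
  the hyperplane orthogonal to \<open>N\<close>.  Touching balls keep points of \<open>K\<close> from lying just above a
  boundary point, so each vertical line meets the boundary at most once inside the cylinder.  The top
  \<open>p + h N\<close> of the axis is outside \<open>K\<close> for the same reason.  The bottom \<open>p - h N\<close> is in \<open>K\<close>: otherwise
  the normal at its nearest point \<open>a\<close> would be close to \<open>N\<close>, which places \<open>p\<close> inside the touching
  ball at \<open>a\<close>.  The bottom is then even interior to \<open>K\<close>, so both facts persist for nearby lines, and
  connectedness yields a boundary point on each of them.
\<close>
lemma frontier_local_graph:
  fixes K :: "'a::euclidean_space set" and n :: "'a \<Rightarrow> 'a"
  assumes "closed K" and \<rho>: "\<rho> > 0"
    and touch: "\<And>q. q \<in> frontier K \<Longrightarrow> touching_normal K \<rho> q (n q)"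
    and cont: "continuous_on (frontier K) n"
    and outer: "\<And>x a. x \<notin> K \<Longrightarrow> a \<in> K \<Longrightarrow> (\<And>z. z \<in> K \<Longrightarrow> dist x a \<le> dist x z) \<Longrightarrow> dist x a < \<rho> \<Longrightarrow>
        a \<in> frontier K \<and> n a = sgn (x - a)"
    and p: "p \<in> frontier K"
  shows "\<exists>U W f. open U \<and> p \<in> U \<and> openin (top_of_set {y. n p \<bullet> y = 0}) W \<and>
      continuously_differentiable_on W f \<and> frontier K \<inter> U = {y + f y *\<^sub>R n p |y. y \<in> W}"
proof -
  define N where "N = n p"
  have frK: "frontier K \<subseteq> K" using \<open>closed K\<close> by (simp add: frontier_subset_eq)
  have unit: "norm (n q) = 1" if "q \<in> frontier K" for q
    using touch[OF that] by (simp add: touching_normal_def)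
  have ineq: "2 * \<rho> * (n q \<bullet> (y - q)) \<le> (norm (y - q))\<^sup>2" if "q \<in> frontier K" "y \<in> K" for q y
    using touch[OF that(1)] that(2) by (simp add: touching_normal_def)
  have N1: "norm N = 1" and NN: "N \<bullet> N = 1" using unit[OF p] by (auto simp: N_def norm_eq_1)
  have pK: "p \<in> K" using p frK by blast
  obtain \<delta>0 where \<delta>0: "\<delta>0 > 0"
    and slope: "\<And>a. a \<in> frontier K \<Longrightarrow> dist a p < \<delta>0 \<Longrightarrow> n a \<bullet> N \<ge> 1 / 2"
  proof -
    have "continuous_on (frontier K) (\<lambda>a. n a \<bullet> N)" by (intro continuous_intros cont)
    then obtain d where "d > 0" and "\<And>a. a \<in> frontier K \<Longrightarrow> dist a p < d \<Longrightarrow> dist (n a \<bullet> N) (n p \<bullet> N) < 1 / 2"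
      using p unfolding continuous_on_iff by (metis half_gt_zero zero_less_one)
    moreover have "n p \<bullet> N = 1" using NN by (simp add: N_def)
    ultimately have "1 / 2 \<le> n a \<bullet> N" if "a \<in> frontier K" "dist a p < d" for a
      using that by (smt (verit) dist_real_def field_sum_of_halves)
    then show thesis using that \<open>d > 0\<close> by blast
  qed
  \<comment> \<open>\<open>4 h < \<rho>\<close> places the bottom of the axis in \<open>K\<close>; all points of the cylinder, and the nearest point
    of the bottom, are within \<open>2 h < \<delta>0\<close> of \<open>p\<close>\<close>
  define h where "h = min (\<rho> / 8) (\<delta>0 / 4)"
  have h: "h > 0" "8 * h \<le> \<rho>" "4 * h \<le> \<delta>0" using \<rho> \<delta>0 by (auto simp: h_def)
  have above: "a + s *\<^sub>R N \<notin> K" if a: "a \<in> frontier K" "dist a p < \<delta>0" and s: "0 < s" "s < \<rho>" for a s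
  proof
    assume "a + s *\<^sub>R N \<in> K"
    from ineq[OF a(1) this] have "2 * \<rho> * (s * (n a \<bullet> N)) \<le> s * s"
      using N1 by (simp add: power2_eq_square)
    moreover have "2 * \<rho> * (s * (1 / 2)) \<le> 2 * \<rho> * (s * (n a \<bullet> N))"
      using slope[OF a] s \<rho> by (intro mult_left_mono) auto
    ultimately have "\<rho> * s \<le> s * s" by simp
    then show False using s by simp
  qed
  have below: "p - h *\<^sub>R N \<in> K"
  proof (rule ccontr)
    define x where "x = p - h *\<^sub>R N"
    assume "p - h *\<^sub>R N \<notin> K"
    then have x: "x \<notin> K" by (simp add: x_def)
    obtain a where a: "a \<in> K" "\<And>z. z \<in> K \<Longrightarrow> dist x a \<le> dist x z"
      using distance_attains_inf[OF \<open>closed K\<close>, of x] pK by blast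
    have xp: "dist x p = h" using N1 h by (simp add: x_def dist_norm)
    then have d: "dist x a \<le> h" using a(2)[OF pK] by simp
    then have "dist x a < \<rho>" using h by linarith
    from outer[OF x a this] have fa: "a \<in> frontier K" and na: "n a = sgn (x - a)" by auto
    have "dist a p \<le> dist x a + dist x p" by (metis dist_commute dist_triangle)
    then have dap: "dist a p \<le> 2 * h" using d xp by linarith
    have "x \<noteq> a" using x a(1) by blast
    then have "x - a = dist x a *\<^sub>R n a" by (simp add: na sgn_div_norm dist_norm)
    then have "p - a = dist x a *\<^sub>R n a + h *\<^sub>R N" by (simp add: x_def algebra_simps)
    then have "n a \<bullet> (p - a) = dist x a + h * (n a \<bullet> N)"
      using unit[OF fa] by (simp add: inner_add_right norm_eq_1)
    moreover have "h * (n a \<bullet> N) \<ge> h * (1 / 2)"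
      using slope[OF fa] dap h by (intro mult_left_mono) auto
    ultimately have "n a \<bullet> (p - a) \<ge> h / 2" using zero_le_dist[of x a] by linarith
    then have "2 * \<rho> * (h / 2) \<le> 2 * \<rho> * (n a \<bullet> (p - a))" using \<rho> by (intro mult_left_mono) auto
    also have "\<dots> \<le> (norm (p - a))\<^sup>2" by (rule ineq[OF fa pK])
    also have "\<dots> \<le> (2 * h)\<^sup>2" using dap by (intro power_mono) (auto simp: dist_norm norm_minus_commute)
    finally have "\<rho> * h \<le> (4 * h) * h" by (simp add: power2_eq_square)
    then show False using h by simp
  qed
  have "p - h *\<^sub>R N \<notin> frontier K"
  proof
    assume "p - h *\<^sub>R N \<in> frontier K"
    from above[OF this, of h] show False using h N1 \<rho> pK \<delta>0 by (simp add: dist_norm)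
  qed
  then have "p - h *\<^sub>R N \<in> interior K" using below closure_subset by (auto simp: frontier_def)
  then obtain d1 where d1: "d1 > 0" "ball (p - h *\<^sub>R N) d1 \<subseteq> interior K"
    by (meson open_contains_ball open_interior)
  have "p + h *\<^sub>R N \<in> - K" using above[OF p, of h] h \<rho> \<delta>0 by simp
  then obtain d2 where d2: "d2 > 0" "ball (p + h *\<^sub>R N) d2 \<subseteq> - K"
    using \<open>closed K\<close> by (meson open_Compl open_contains_ball)
  \<comment> \<open>over this disc the floor of the cylinder is inside \<open>K\<close> and its lid outside\<close>
  define \<delta> where "\<delta> = min (min d1 d2) h"
  have \<delta>: "\<delta> > 0" "\<delta> \<le> d1" "\<delta> \<le> d2" "\<delta> \<le> h" using d1 d2 h by (auto simp: \<delta>_def)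
  define \<pi> where "\<pi> x = x - (N \<bullet> x) *\<^sub>R N" for x
  define c where "c = N \<bullet> p"
  have \<pi>N: "N \<bullet> \<pi> x = 0" for x by (simp add: \<pi>_def inner_diff_right NN)
  have p_eq: "p = \<pi> p + c *\<^sub>R N" by (simp add: \<pi>_def c_def)
  define U where "U = {x. norm (\<pi> x - \<pi> p) < \<delta> \<and> \<bar>N \<bullet> x - c\<bar> < h}"
  define W where "W = {y. N \<bullet> y = 0} \<inter> ball (\<pi> p) \<delta>"
  have "open U" unfolding U_def \<pi>_def
    by (intro open_Collect_conj open_Collect_less continuous_intros)
  have "p \<in> U" using \<delta> h by (simp add: U_def c_def)
  have oW: "openin (top_of_set {y. N \<bullet> y = 0}) W" unfolding W_def by (intro openin_open_Int open_ball)
  have Wd: "norm (y - \<pi> p) < \<delta>" "N \<bullet> y = 0" if "y \<in> W" for y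
    using that by (auto simp: W_def dist_norm norm_minus_commute)
  have near: "dist (y + s *\<^sub>R N) p < \<delta>0" if y: "y \<in> W" and s: "\<bar>s - c\<bar> < h" for y s
  proof -
    have "y + s *\<^sub>R N - p = (y - \<pi> p) + (s - c) *\<^sub>R N" by (subst p_eq) (simp add: algebra_simps)
    then have "dist (y + s *\<^sub>R N) p \<le> norm (y - \<pi> p) + \<bar>s - c\<bar>"
      using norm_triangle_ineq[of "y - \<pi> p" "(s - c) *\<^sub>R N"] N1 by (simp only: dist_norm norm_scaleR mult_1_right)
    then show ?thesis using Wd(1)[OF y] s \<delta> h by linarith
  qed
  have "\<exists>s. \<bar>s - c\<bar> < h \<and> y + s *\<^sub>R N \<in> frontier K" if y: "y \<in> W" for y
  proof -
    define A where "A = y + (c - h) *\<^sub>R N"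
    define B where "B = y + (c + h) *\<^sub>R N"
    have "A - (p - h *\<^sub>R N) = y - \<pi> p" by (subst p_eq) (simp add: A_def algebra_simps)
    then have "A \<in> ball (p - h *\<^sub>R N) d1"
      using Wd(1)[OF y] \<delta> by (simp add: dist_norm norm_minus_commute)
    then have A: "A \<in> interior K" using d1 by blast
    have "B - (p + h *\<^sub>R N) = y - \<pi> p" by (subst p_eq) (simp add: B_def algebra_simps)
    then have "B \<in> ball (p + h *\<^sub>R N) d2"
      using Wd(1)[OF y] \<delta> by (simp add: dist_norm norm_minus_commute)
    then have B: "B \<notin> K" using d2 by blast
    have "closed_segment A B \<inter> frontier K \<noteq> {}"
      using A B interior_subset by (intro connected_Int_frontier) auto
    then obtain u where u: "0 \<le> u" "u \<le> 1" and fr: "(1 - u) *\<^sub>R A + u *\<^sub>R B \<in> frontier K"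
      by (auto simp: closed_segment_def)
    have "u \<noteq> 0" using fr A by (auto simp: frontier_def)
    moreover have "u \<noteq> 1" using fr B frK by auto
    ultimately have u': "0 < u" "u < 1" using u by auto
    have "(1 - u) *\<^sub>R A + u *\<^sub>R B = y + (c + (2 * u - 1) * h) *\<^sub>R N"
      by (simp add: A_def B_def algebra_simps flip: scaleR_add_left)
    moreover have "\<bar>(2 * u - 1) * h\<bar> < h" using u' h by (simp add: abs_mult)
    ultimately show ?thesis using fr by (intro exI[of _ "c + (2 * u - 1) * h"]) simp
  qed
  then obtain f where f: "\<And>y. y \<in> W \<Longrightarrow> \<bar>f y - c\<bar> < h"
    and ffr: "\<And>y. y \<in> W \<Longrightarrow> y + f y *\<^sub>R N \<in> frontier K" by metis
  have no_two: False if "y \<in> W" "\<bar>s - c\<bar> < h" "\<bar>s' - c\<bar> < h" "s < s'"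
    "y + s *\<^sub>R N \<in> frontier K" "y + s' *\<^sub>R N \<in> frontier K" for y s s'
  proof -
    have "y + s *\<^sub>R N + (s' - s) *\<^sub>R N \<notin> K"
      using that h by (intro above near) auto
    then show False using that frK by (auto simp: algebra_simps)
  qed
  have "frontier K \<inter> U = {y + f y *\<^sub>R N |y. y \<in> W}"
  proof (intro equalityI subsetI)
    fix x assume x: "x \<in> frontier K \<inter> U"
    define y where "y = \<pi> x"
    have x_eq: "x = y + (N \<bullet> x) *\<^sub>R N" by (simp add: y_def \<pi>_def)
    have y: "y \<in> W" using x \<pi>N by (auto simp: y_def W_def U_def dist_norm norm_minus_commute)
    have s: "\<bar>N \<bullet> x - c\<bar> < h" using x by (simp add: U_def)
    have xf: "y + (N \<bullet> x) *\<^sub>R N \<in> frontier K" using x x_eq by simp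
    have "f y = N \<bullet> x"
      using no_two[OF y s f[OF y] _ xf ffr[OF y]] no_two[OF y f[OF y] s _ ffr[OF y] xf]
      by (meson linorder_neqE_linordered_idom)
    with x_eq have "x = y + f y *\<^sub>R N" by (simp only:)
    then show "x \<in> {y + f y *\<^sub>R N |y. y \<in> W}" using y by blast
  next
    fix x assume "x \<in> {y + f y *\<^sub>R N |y. y \<in> W}"
    then obtain y where y: "y \<in> W" "x = y + f y *\<^sub>R N" by blast
    have Nx: "N \<bullet> x = f y" using Wd(2)[OF y(1)] y(2) by (simp add: inner_add_right NN)
    then have "\<pi> x = y" using y(2) by (simp add: \<pi>_def)
    then have "x \<in> U" using Nx Wd(1)[OF y(1)] f[OF y(1)] by (simp add: U_def)
    then show "x \<in> frontier K \<inter> U" using ffr[OF y(1)] y(2) by simp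
  qed
  moreover have "continuously_differentiable_on W f"
  proof (rule graph_continuously_differentiable[OF N1 \<rho> Wd(2) _ _ ffr cont unit])
    fix y y' assume y: "y \<in> W" and y': "y' \<in> W"
    have "norm (y' - y) \<le> norm (y' - \<pi> p) + norm (y - \<pi> p)"
      by (metis dist_norm dist_triangle2)
    then show "norm (y' - y) \<le> \<rho> / 2" using Wd(1)[OF y] Wd(1)[OF y'] \<delta> h by linarith
    show "\<bar>f y' - f y\<bar> \<le> \<rho> / 2" using f[OF y] f[OF y'] h by linarith
  next
    fix y assume y: "y \<in> W"
    show "1 / 2 \<le> n (y + f y *\<^sub>R N) \<bullet> N" by (rule slope[OF ffr[OF y] near[OF y f[OF y]]])
  next
    fix q q' assume "q \<in> frontier K" "q' \<in> frontier K"
    then show "2 * \<rho> * (n q \<bullet> (q' - q)) \<le> (norm (q' - q))\<^sup>2" using ineq frK by blast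
  qed
  ultimately show ?thesis using \<open>open U\<close> \<open>p \<in> U\<close> oW unfolding N_def by blast
qed

section \<open>Change of coordinates\<close>

text \<open>
  The reflection in the hyperplane orthogonal to \<open>N - e\<close>.  Being an orthogonal involution, it is its own
  adjoint and inverse, which keeps the change of coordinates below short.
\<close>
lemma unit_vector_reflection:
  fixes N e :: "'a::euclidean_space"
  assumes "norm N = 1" "norm e = 1"
  obtains Q where "orthogonal_transformation Q" "Q N = e" "\<And>x. Q (Q x) = x"
proof -
  define w where "w = N - e"
  \<comment> \<open>for \<open>N = e\<close> the quotient is \<open>0 / 0 = 0\<close>, and \<open>Q\<close> is the identity, as it should be\<close>
  define Q where "Q x = x - (2 * (w \<bullet> x) / (w \<bullet> w)) *\<^sub>R w" for x
  have inn: "N \<bullet> N = 1" "e \<bullet> e = 1" using assms by (auto simp: norm_eq_1)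
  have "linear Q"
    by (rule linearI) (simp_all add: Q_def inner_add_right add_divide_distrib algebra_simps)
  moreover have "Q x \<bullet> Q y = x \<bullet> y" for x y
    by (cases "w = 0") (simp_all add: Q_def inner_diff inner_commute field_simps)
  ultimately have "orthogonal_transformation Q" by (simp add: orthogonal_transformation_def)
  moreover have "Q N = e"
  proof (cases "w = 0")
    case False
    have "w \<bullet> w = 2 * (w \<bullet> N)" using inn by (simp add: w_def inner_diff inner_commute)
    moreover have "w \<bullet> w \<noteq> 0" using False by simp
    ultimately have "Q N = N - w" by (simp add: Q_def)
    then show ?thesis by (simp add: w_def)
  qed (simp add: Q_def w_def)
  moreover have "Q (Q x) = x" for x
    by (cases "w = 0") (simp_all add: Q_def inner_diff_right field_simps)
  ultimately show thesis by (rule that)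
qed

text \<open>
  The axis of a local graph may be any unit vector: a reflection takes it to a basis vector, and
  carries the gradient field along.
\<close>
lemma C1_hypersurfaceI:
  fixes M :: "'a::euclidean_space set"
  assumes "\<And>p. p \<in> M \<Longrightarrow> \<exists>N U W f. norm N = 1 \<and> open U \<and> p \<in> U \<and>
      openin (top_of_set {y. N \<bullet> y = 0}) W \<and> continuously_differentiable_on W f \<and>
      M \<inter> U = {y + f y *\<^sub>R N |y. y \<in> W}"
  shows "C1_hypersurface M"
  unfolding C1_hypersurface_def
proof
  fix p assume "p \<in> M"
  from assms[OF this] obtain N U W f where N: "norm N = 1" and U: "open U" "p \<in> U"
    and W: "openin (top_of_set {y. N \<bullet> y = 0}) W" and f: "continuously_differentiable_on W f"
    and graph: "M \<inter> U = {y + f y *\<^sub>R N |y. y \<in> W}" by blast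
  obtain e :: 'a where e: "e \<in> Basis" using nonempty_Basis by blast
  obtain Q where Q: "orthogonal_transformation Q" and QN: "Q N = e" and QQ: "\<And>x. Q (Q x) = x"
    using unit_vector_reflection[OF N] e by (metis norm_Basis)
  have lin: "linear Q" using Q by (rule orthogonal_transformation_linear)
  have Qin: "Q x \<bullet> Q y = x \<bullet> y" for x y using Q by (simp add: orthogonal_transformation_def)
  have adj: "Q x \<bullet> y = x \<bullet> Q y" for x y by (metis Qin QQ)
  have contQ: "continuous_on S Q" for S using lin by (rule linear_continuous_on_compose[OF continuous_on_id])
  have QQim: "Q ` Q ` S = S" for S by (auto simp: image_image QQ)
  have Qvim: "Q ` S = Q -` S" for S by (auto simp: image_iff QQ) (metis QQ)
  have "rigid_motion Q" unfolding rigid_motion_def using Q by (intro exI[of _ Q] exI[of _ 0]) auto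
  moreover have "openin (top_of_set (coord_hyperplane e)) (Q ` W)"
  proof -
    obtain V where V: "open V" "W = {y. N \<bullet> y = 0} \<inter> V" using W by (auto simp: openin_open)
    have "Q ` W = coord_hyperplane e \<inter> Q -` V"
      unfolding Qvim V(2) coord_hyperplane_def by (auto simp: adj QN[symmetric])
    moreover have "open (Q -` V)" using V(1) contQ by (simp add: open_vimage)
    ultimately show ?thesis by (simp add: openin_open_Int)
  qed
  moreover have "continuously_differentiable_on (Q ` W) (f \<circ> Q)"
  proof -
    obtain G where G: "continuous_on W G"
      and der: "\<And>y. y \<in> W \<Longrightarrow> (f has_derivative (\<lambda>h. G y \<bullet> h)) (at y within W)"
      using f unfolding continuously_differentiable_on_def by blast
    have "continuous_on (Q ` W) (G \<circ> Q)" by (intro continuous_on_compose contQ) (simp add: QQim G)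
    then have "continuous_on (Q ` W) (\<lambda>y. Q (G (Q y)))"
      by (intro continuous_on_compose2[OF contQ[of UNIV]]) (auto simp: o_def)
    moreover have "(f \<circ> Q has_derivative (\<lambda>h. Q (G (Q y)) \<bullet> h)) (at y within Q ` W)" if "y \<in> Q ` W" for y
    proof -
      have "Q y \<in> W" using that QQ by auto
      then have "(f has_derivative (\<lambda>h. G (Q y) \<bullet> h)) (at (Q y) within Q ` Q ` W)"
        using der QQim by simp
      from diff_chain_within[OF linear_imp_has_derivative[OF lin] this]
      show ?thesis by (simp add: o_def adj)
    qed
    ultimately show ?thesis unfolding continuously_differentiable_on_def by blast
  qed
  moreover have "Q ` (M \<inter> U) = {y + (f \<circ> Q) y *\<^sub>R e |y. y \<in> Q ` W}"
  proof -
    have "Q (y + f y *\<^sub>R N) = Q y + (f \<circ> Q) (Q y) *\<^sub>R e" for y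
      by (simp add: linear_add[OF lin] linear_scale[OF lin] QN QQ)
    then show ?thesis unfolding graph by (fastforce simp: image_iff)
  qed
  ultimately show "\<exists>U T e W f. open U \<and> p \<in> U \<and> rigid_motion T \<and> e \<in> Basis \<and>
      openin (top_of_set (coord_hyperplane e)) W \<and> continuously_differentiable_on W f \<and>
      T ` (M \<inter> U) = {y + f y *\<^sub>R e |y. y \<in> W}"
    using U e by blast
qed

theorem theorem4p5:
  fixes K :: "'a::euclidean_space set"
  assumes "positive_reach K"
    and "\<And>p. p \<in> frontier K \<Longrightarrow> half_space (tangent_cone K p)"
  shows "C1_hypersurface (frontier K)"
proof -
  obtain r where K: "closed K" and r: "r > 0" and U: "unique_nearest K r"
    using assms(1) unfolding positive_reach_def unique_nearest_def by blast
  define \<rho> where "\<rho> = r / 2"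
  have \<rho>: "0 < \<rho>" "\<rho> < r" using r by (auto simp: \<rho>_def)
  define n where "n p = (SOME v. touching_normal K \<rho> p v)" for p
  have touch: "touching_normal K \<rho> p (n p)" if "p \<in> frontier K" for p
    unfolding n_def by (rule someI_ex[OF frontier_has_touching_normal[OF K U \<rho> that]])
  have unique: "v = n p" if "p \<in> frontier K" "touching_normal K \<rho> p v" for p v
    by (rule touching_normal_unique[OF assms(2)[OF that(1)] \<rho>(1) that(2) touch[OF that(1)]])
  have cont: "continuous_on (frontier K) n"
    by (rule continuous_touching_normal_field[OF K touch unique])
  have outer: "a \<in> frontier K \<and> n a = sgn (x - a)"
    if "x \<notin> K" "a \<in> K" "\<And>z. z \<in> K \<Longrightarrow> dist x a \<le> dist x z" "dist x a < \<rho>" for x a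
  proof -
    have t: "touching_normal K \<rho> a (sgn (x - a))"
      by (rule touching_normal_at_nearest_point[OF K U that(2,3,1,4) \<rho>(2)])
    have "a \<in> frontier K" by (rule touching_normal_imp_frontier[OF t that(2) \<rho>(1)])
    then show ?thesis using unique t by metis
  qed
  show ?thesis
  proof (rule C1_hypersurfaceI)
    fix p assume p: "p \<in> frontier K"
    have "norm (n p) = 1" using touch[OF p] by (simp add: touching_normal_def)
    then show "\<exists>N U W f. norm N = 1 \<and> open U \<and> p \<in> U \<and>
      openin (top_of_set {y. N \<bullet> y = 0}) W \<and> continuously_differentiable_on W f \<and>
      frontier K \<inter> U = {y + f y *\<^sub>R N |y. y \<in> W}"
      using frontier_local_graph[OF K \<rho>(1) touch cont outer p] by blast
  qed
qed

end
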